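(* Let $q$ be any prime power. Then $s_{q^4/q}(3,2)=5$; that is, the smallest rank of a $1$-saturating $\mathbb{F}_q$-linear set in $\mathrm{PG}(2,q^4)$ is $5$.
   Context: Let $V=\mathbb{F}_{q^4}^3$ and $\mathrm{PG}(2,q^4)=\mathrm{PG}(V,\mathbb{F}_{q^4})$. For an $\mathbb{F}_q$-subspace $U$ of $V$ with $\dim_{\mathbb{F}_q}U=n$, the set $L_U=\{\langle u\rangle_{\mathbb{F}_{q^4}} : u\in U\setminus\{0\}\}$ is called an $\mathbb{F}_q$-linear set of rank $n$. An $\mathbb{F}_q$-linear set $L_U$ in $\mathrm{PG}(2,q^4)$ is $1$-saturating if every point of $\mathrm{PG}(2,q^4)$ lies on at least one line meeting $L_U$ in at least two points (a secant line to $L_U$). The quantity $s_{q^4/q}(3,2)$ denotes the smallest rank of a $1$-saturating $\mathbb{F}_q$-linear set in $\mathrm{PG}(2,q^4)$. *)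

theory Defs
  imports "HOL-Analysis.Analysis" "HOL-Number_Theory.Prime_Powers"
begin

text \<open>
  A unital ring homomorphism \<open>\<iota>\<close> between fields \<open>'k\<close> and \<open>'l\<close> is injective; it identifies
  \<open>'k\<close> with the subfield \<open>range \<iota>\<close> of \<open>'l\<close>.
\<close>

definition field_embedding :: "('k::field \<Rightarrow> 'l::field) \<Rightarrow> bool" where
  "field_embedding \<iota> \<longleftrightarrow>
     \<iota> 1 = 1 \<and> (\<forall>x y. \<iota> (x + y) = \<iota> x + \<iota> y) \<and> (\<forall>x y. \<iota> (x * y) = \<iota> x * \<iota> y)"

definition restrict_scale :: "('k::field \<Rightarrow> 'l::field) \<Rightarrow> 'k \<Rightarrow> 'l^'n \<Rightarrow> 'l^'n" where
  "restrict_scale \<iota> c v = \<iota> c *s v"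

lemma vector_space_restrict_scale:
  assumes "field_embedding \<iota>"
  shows "vector_space (restrict_scale \<iota> :: 'k::field \<Rightarrow> 'l::field^'n \<Rightarrow> 'l^'n)"
  using assms
  by unfold_locales
    (auto simp: field_embedding_def restrict_scale_def vec.scale_right_distrib
      vec.scale_left_distrib)

text \<open>
  \<open>*s\<close>, \<open>vec.span\<close>, \<open>vec.subspace\<close> and \<open>vec.dim\<close> refer to the big field \<open>'l\<close>, whereas
  \<open>module.subspace\<close> and \<open>vector_space.dim\<close> at \<open>restrict_scale \<iota>\<close> refer to \<open>'k\<close>.
  Points and lines of the projective space are vector subspaces, and incidence is inclusion.
\<close>

definition pg_point :: "('l::field^'n) set \<Rightarrow> bool" where
  "pg_point P \<longleftrightarrow> vec.subspace P \<and> vec.dim P = 1"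

definition pg_line :: "('l::field^'n) set \<Rightarrow> bool" where
  "pg_line l \<longleftrightarrow> vec.subspace l \<and> vec.dim l = 2"

definition linear_set :: "('l::field^'n) set \<Rightarrow> ('l^'n) set set" where
  "linear_set U = {vec.span {u} | u. u \<in> U - {0}}"

definition secant_line :: "('l::field^'n) set set \<Rightarrow> ('l^'n) set \<Rightarrow> bool" where
  "secant_line L l \<longleftrightarrow> pg_line l \<and> (\<exists>P\<in>L. \<exists>Q\<in>L. P \<noteq> Q \<and> P \<subseteq> l \<and> Q \<subseteq> l)"

definition one_saturating :: "('l::field^'n) set set \<Rightarrow> bool" where
  "one_saturating L \<longleftrightarrow> (\<forall>P. pg_point P \<longrightarrow> (\<exists>l. secant_line L l \<and> P \<subseteq> l))"

text \<open>
  The rank of a linear set is the dimension over \<open>'k\<close> of the subspace \<open>U\<close> defining it.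
  An infimum of naturals is a minimum when the set is nonempty, and \<open>0\<close> otherwise; so a
  positive value is attained.
\<close>

definition min_saturating_rank :: "('k::field \<Rightarrow> 'l::field) \<Rightarrow> nat" where
  "min_saturating_rank \<iota> =
     Inf {n. \<exists>U :: ('l^3) set. module.subspace (restrict_scale \<iota>) U \<and>
               vector_space.dim (restrict_scale \<iota>) U = n \<and> one_saturating (linear_set U)}"

end

theory Submission
  imports Defs
begin

text \<open>
  Write \<open>F\<close> for the big field and \<open>K\<close> for the small one.

  A rank 5 example is \<open>H \<times> K \<times> K\<close>, where \<open>H \<subseteq> F\<close> consists of the elements of trace zero.
  Up to scaling, the critical points are \<open>(s, 1, t)\<close> with \<open>t \<notin> K\<close>. Since \<open>H + t H = F\<close>, we can
  write \<open>s = h + t h'\<close>, and \<open>(s, 1, t) = (h, 1, 0) + t (h', 0, 1)\<close>.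

  Conversely, let \<open>U\<close> have rank 4 and span \<open>F\<^sup>3\<close>. A \<open>K\<close>-basis \<open>b\<^sub>1, \<dots>, b\<^sub>4\<close> of \<open>U\<close> satisfies a relation
  \<open>\<Sum> m\<^sub>i b\<^sub>i = 0\<close> over \<open>F\<close>, unique up to a factor. So \<open>\<Sum> x\<^sub>i b\<^sub>i\<close> lies on no secant line if for every
  \<open>\<theta>\<close> the entries of \<open>x - \<theta> m\<close> span at least 3 dimensions over \<open>K\<close>. Choosing the basis such that the
  nonzero \<open>m\<^sub>i\<close> are linearly independent over \<open>K\<close>, such an \<open>x\<close> is found according to their number:
  four: \<open>x\<^sub>i = m\<^sub>i\<^sup>q\<close>; three: \<open>x\<close> with \<open>x\<^sub>i\<^sup>q - x\<^sub>i = \<mu> m\<^sub>i\<close> for a suitable \<open>\<mu>\<close>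
  and \<open>x\<^sub>4 = 1\<close>; two:
  \<open>x = (s, 0, 1, t)\<close> with \<open>t = m\<^sub>2 / m\<^sub>1\<close> and \<open>s\<close> outside the \<open>K\<close>-span of \<open>1, t, 1/t\<close>. In the first two
  cases the entries of \<open>x - \<theta> m\<close> are images of a \<open>K\<close>-basis of \<open>F\<close> under some \<open>z \<mapsto> a z + b z\<^sup>q\<close>, whose
  kernel has dimension at most 1.
\<close>

section \<open>Counting and root bounds in finite fields\<close>

lemma card_le_mult_card_image:
  assumes "finite A" and "\<And>y. y \<in> f ` A \<Longrightarrow> card {x \<in> A. f x = y} \<le> m"
  shows "card A \<le> m * card (f ` A)"
proof -
  have "card A = card (\<Union>y\<in>f ` A. {x \<in> A. f x = y})"
    by (rule arg_cong[of _ _ card]) auto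
  also have "\<dots> \<le> (\<Sum>y\<in>f ` A. card {x \<in> A. f x = y})"
    using assms(1) by (intro card_UN_le) auto
  also have "\<dots> \<le> of_nat (card (f ` A)) * m"
    by (rule sum_bounded_above) (use assms(2) in auto)
  finally show ?thesis
    by (simp add: mult.commute)
qed

text \<open>Translation by 1 permutes the elements, so their sum is unchanged although each summand
  gains 1. This ties the characteristic to the cardinality.\<close>

lemma of_nat_card_UNIV_eq_0: "of_nat CARD('a) = (0 :: 'a::{ring_1,finite})"
proof -
  have "(\<Sum>x\<in>UNIV. x) = (\<Sum>x\<in>UNIV. x + (1::'a))"
    by (rule sum.reindex_bij_witness[of _ "\<lambda>x. x + 1" "\<lambda>x. x - 1"]) auto
  then show ?thesis
    by (simp add: sum.distrib)
qed

lemma power_card_UNIV_eq: "(x :: 'a::{field,finite}) ^ CARD('a) = x"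
proof (cases "x = 0")
  case False
  have "(\<Prod>y\<in>UNIV - {0}. x * y) = (\<Prod>y\<in>UNIV - {0}. y)"
    by (rule prod.reindex_bij_witness[of _ "\<lambda>y. y / x" "\<lambda>y. x * y"]) (use False in auto)
  then have "x ^ (CARD('a) - 1) = 1"
    by (simp add: prod.distrib card_Diff_singleton)
  then show ?thesis
    by (metis Suc_diff_1 mult.right_neutral power_Suc zero_less_card_finite)
qed simp

text \<open>The set consists of the roots of a polynomial of degree at most \<open>q\<close>. Since
  \<open>1 < q\<close>, its terms have distinct degrees, so \<open>a\<close> and \<open>b\<close>
  survive as coefficients.\<close>

lemma card_power_eq_linear_le:
  fixes a b c :: "'a::{field,finite}"
  assumes "1 < q" and "a \<noteq> 0 \<or> b \<noteq> 0"
  shows "card {z. a * z + b * z ^ q = c} \<le> q"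
proof -
  define P where "P = monom b q + monom a 1 - [:c:]"
  have "coeff P q = b" "coeff P 1 = a"
    using assms(1) by (auto simp: P_def coeff_eq_0 simp flip: monom_0)
  with assms(2) have "P \<noteq> 0"
    by auto
  then have "card {z. poly P z = 0} \<le> degree P"
    by (rule card_poly_roots_bound)
  also have "degree P \<le> q"
    unfolding P_def using assms(1)
    by (intro degree_diff_le degree_add_le) (auto intro: order.trans[OF degree_monom_le])
  also have "{z. poly P z = 0} = {z. a * z + b * z ^ q = c}"
    by (auto simp: P_def poly_monom algebra_simps)
  finally show ?thesis .
qed

section \<open>The embedded subfield and the Frobenius map\<close>

locale quartic_extension =
  fixes q :: nat and \<iota> :: "'k::{field,finite} \<Rightarrow> 'l::{field,finite}"
  assumes primepow_q: "primepow q"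
    and card_k: "CARD('k) = q"
    and card_l: "CARD('l) = q ^ 4"
    and embedding: "field_embedding \<iota>"
begin

lemma q_gt_1: "1 < q"
  using primepow_gt_Suc_0[OF primepow_q] by simp

lemma emb_1 [simp]: "\<iota> 1 = 1"
  and emb_add: "\<iota> (a + b) = \<iota> a + \<iota> b"
  and emb_mult: "\<iota> (a * b) = \<iota> a * \<iota> b"
  using embedding by (auto simp: field_embedding_def)

lemma emb_0 [simp]: "\<iota> 0 = 0"
  by (metis add_0 add_cancel_left_left emb_add)

lemma emb_uminus: "\<iota> (- a) = - \<iota> a"
  using emb_add[of a "- a"] by (simp add: eq_neg_iff_add_eq_0 add.commute)

lemma emb_diff: "\<iota> (a - b) = \<iota> a - \<iota> b"
  using emb_add[of a "- b"] by (simp add: emb_uminus)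

lemma emb_eq_0 [simp]: "\<iota> a = 0 \<longleftrightarrow> a = 0"
proof
  assume "\<iota> a = 0"
  then show "a = 0"
    using emb_mult[of a "inverse a"] by (cases "a = 0") auto
qed simp

lemma emb_eq_iff [simp]: "\<iota> a = \<iota> b \<longleftrightarrow> a = b"
  using emb_eq_0[of "a - b"] by (simp add: emb_diff)

lemma emb_divide: "\<iota> (a / b) = \<iota> a / \<iota> b"
proof (cases "b = 0")
  case False
  then show ?thesis
    using emb_mult[of "a / b" b] by (simp add: field_simps)
qed simp

lemma emb_power: "\<iota> (a ^ n) = \<iota> a ^ n"
  by (induction n) (auto simp: emb_mult)

lemma card_range_emb: "card (range \<iota>) = q"
  using card_image[of \<iota> UNIV] card_k by (simp add: inj_on_def)

text \<open>The characteristic divides \<open>CARD('l)\<close>, a power of the prime below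
  \<open>q\<close>, and so equals that prime. Powers of \<open>q\<close> are then powers of the
  characteristic.\<close>

lemma frob_add: "(x + y :: 'l) ^ q ^ n = x ^ q ^ n + y ^ q ^ n"
proof -
  obtain p e where pe: "prime p" "q = p ^ e"
    using primepow_q by (auto simp: primepow_def)
  have prime: "prime CHAR('l)"
    using finite_imp_CHAR_pos[where 'a = 'l] by (intro prime_CHAR_semidom) auto
  have "CHAR('l) dvd q ^ 4"
    using of_nat_card_UNIV_eq_0[where 'a = 'l] unfolding of_nat_eq_0_iff_char_dvd card_l .
  then have "CHAR('l) dvd p"
    unfolding pe using prime prime_dvd_power by metis
  then have "CHAR('l) = p"
    using pe prime primes_dvd_imp_eq by blast
  then show ?thesis
    using freshmans_dream'[OF prime, of "q ^ n" "e * n" x y] by (simp add: pe power_mult)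
qed

lemma frob_add1: "(x + y :: 'l) ^ q = x ^ q + y ^ q"
  using frob_add[of x y 1] by simp

lemma frob_sum: "(\<Sum>i\<in>A. f i :: 'l) ^ q = (\<Sum>i\<in>A. f i ^ q)"
  using q_gt_1 by (induction A rule: infinite_finite_induct) (auto simp: frob_add1)

lemma emb_frob: "\<iota> a ^ q ^ n = \<iota> a"
proof -
  have "\<iota> a ^ q = \<iota> a"
    using power_card_UNIV_eq[of a] card_k by (simp flip: emb_power)
  then show ?thesis
    by (induction n) (simp_all add: power_mult)
qed

lemma emb_frob1: "\<iota> a ^ q = \<iota> a"
  using emb_frob[of a 1] by simp

lemma frob_4: "(x::'l) ^ q ^ 4 = x"
  using power_card_UNIV_eq[of x] card_l by simp

text \<open>The \<open>q\<close> elements of the subfield already exhaust the at most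
  \<open>q\<close> roots of \<open>z ^ q - z\<close>.\<close>

lemma frob_fixed:
  assumes "(x::'l) ^ q = x"
  shows "x \<in> range \<iota>"
proof -
  have "range \<iota> \<subseteq> {z. (- 1) * z + 1 * z ^ q = 0}"
    by (auto simp: emb_frob1)
  moreover have "card {z::'l. (- 1) * z + 1 * z ^ q = 0} \<le> q"
    by (rule card_power_eq_linear_le[OF q_gt_1]) auto
  ultimately have "range \<iota> = {z. (- 1) * z + 1 * z ^ q = 0}"
    by (intro card_subset_eq) (auto simp: card_range_emb intro!: antisym
        dest: card_mono[rotated])
  with assms show ?thesis
    by auto
qed

section \<open>The trace, its kernel, and additive Hilbert 90\<close>

definition Tr :: "'l \<Rightarrow> 'l" where
  "Tr x = x + x ^ q + x ^ q ^ 2 + x ^ q ^ 3"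

lemma Tr_add: "Tr (x + y) = Tr x + Tr y"
  by (simp add: Tr_def frob_add1 frob_add)

lemma Tr_0 [simp]: "Tr 0 = 0"
  by (metis add_0 add_cancel_left_left Tr_add)

lemma Tr_uminus: "Tr (- x) = - Tr x"
  using Tr_add[of x "- x"] by (simp add: eq_neg_iff_add_eq_0 add.commute)

lemma Tr_diff: "Tr (x - y) = Tr x - Tr y"
  using Tr_add[of x "- y"] by (simp add: Tr_uminus)

lemma Tr_scale: "Tr (\<iota> a * x) = \<iota> a * Tr x"
  by (simp add: Tr_def power_mult_distrib emb_frob emb_frob1 algebra_simps)

lemma frob_iterate:
  fixes x :: 'l
  shows "(x ^ q) ^ q = x ^ q ^ 2" "(x ^ q ^ 2) ^ q = x ^ q ^ 3" "(x ^ q ^ 3) ^ q = x"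
    "(x ^ q) ^ q ^ 2 = x ^ q ^ 3" "(x ^ q) ^ q ^ 3 = x"
  using frob_4[of x]
  by (simp_all flip: power_mult add: power2_eq_square power3_eq_cube power4_eq_xxxx mult_ac)

lemma Tr_in_range: "Tr x \<in> range \<iota>"
  by (rule frob_fixed) (simp add: Tr_def frob_add1 frob_iterate algebra_simps)

lemma Tr_frob_diff: "Tr (y ^ q - y) = 0"
  by (simp add: Tr_diff) (simp add: Tr_def frob_iterate)

text \<open>The sharper bound for \<open>d = 0\<close> is what makes the count in
  \<open>Tr_mult_nonzero\<close> work.\<close>

lemma card_linearized_roots_le:
  fixes a b c d :: 'l
  assumes "a \<noteq> 0 \<or> b \<noteq> 0 \<or> c \<noteq> 0 \<or> d \<noteq> 0"
  shows "card {z. a * z + b * z ^ q + c * z ^ q ^ 2 + d * z ^ q ^ 3 = 0}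
    \<le> q ^ (if d = 0 then 2 else 3)"
proof -
  define P where "P = monom d (q ^ 3) + monom c (q ^ 2) + monom b q + monom a 1"
  have lt: "1 < q" "q < q ^ 2" "q ^ 2 < q ^ 3" "q < q ^ 3" "1 < q ^ 2" "1 < q ^ 3"
    using q_gt_1 power_strict_increasing[of 1 2 q] power_strict_increasing[of 2 3 q]
      power_strict_increasing[of 0 3 q] power_strict_increasing[of 1 3 q] by auto
  have "coeff P (q ^ 3) = d" "coeff P (q ^ 2) = c" "coeff P q = b" "coeff P 1 = a"
    using lt by (auto simp: P_def)
  with assms(1) have "P \<noteq> 0"
    by auto
  then have "card {z. poly P z = 0} \<le> degree P"
    by (rule card_poly_roots_bound)
  also have "degree P \<le> q ^ (if d = 0 then 2 else 3)"
    unfolding P_def using lt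
    by (intro degree_add_le) (auto intro: order.trans[OF degree_monom_le])
  also have "{z. poly P z = 0} = {z. a * z + b * z ^ q + c * z ^ q ^ 2 + d * z ^ q ^ 3 = 0}"
    by (auto simp: P_def poly_monom algebra_simps)
  finally show ?thesis .
qed

text \<open>One squeeze gives both claims. The image of \<open>y ^ q - y\<close> lies in the kernel
  and has at least \<open>q ^ 3\<close> elements, as its fibres have at most \<open>q\<close>; the
  kernel, as a root set, has at most \<open>q ^ 3\<close>.\<close>

lemma
  shows card_ker_Tr: "card {z. Tr z = 0} = q ^ 3"
    and ker_Tr_eq: "{z. Tr z = 0} = range (\<lambda>y. y ^ q - y)"
proof -
  let ?I = "range (\<lambda>y::'l. y ^ q - y)"
  have sub: "?I \<subseteq> {z. Tr z = 0}"
    using Tr_frob_diff by auto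
  have "CARD('l) \<le> q * card ?I"
  proof (rule card_le_mult_card_image)
    show "card {x \<in> UNIV. x ^ q - x = y} \<le> q" for y :: 'l
      using card_power_eq_linear_le[OF q_gt_1, of "-1" 1 y] by simp
  qed simp
  then have "q ^ 3 \<le> card ?I"
    using q_gt_1 by (simp add: card_l numeral_eq_Suc)
  moreover have "card {z. Tr z = 0} \<le> q ^ 3"
    using card_linearized_roots_le[of 1 1 1 1] by (simp add: Tr_def)
  moreover have "card ?I \<le> card {z. Tr z = 0}"
    by (rule card_mono[OF _ sub]) simp
  ultimately have card: "card {z. Tr z = 0} = q ^ 3" "card ?I = card {z. Tr z = 0}"
    by linarith+
  show "card {z. Tr z = 0} = q ^ 3"
    by (fact card(1))
  show "{z. Tr z = 0} = ?I"
    by (rule card_subset_eq[OF finite sub card(2), symmetric])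
qed

lemma additive_Hilbert_90:
  assumes "Tr z = 0"
  obtains y where "z = y ^ q - y"
proof -
  have "z \<in> range (\<lambda>y. y ^ q - y)"
    unfolding ker_Tr_eq[symmetric] using assms by (rule CollectI)
  then show ?thesis
    using that by blast
qed

text \<open>Subtracting \<open>t ^ q ^ 3 * Tr h\<close> from \<open>Tr (t * h)\<close> cancels the
  highest power of \<open>h\<close>. What remains has at most \<open>q ^ 2\<close> zeros, too few to
  contain the \<open>q ^ 3\<close> elements of trace zero.\<close>

lemma Tr_mult_nonzero:
  assumes "t \<notin> range \<iota>"
  obtains h where "Tr h = 0" and "Tr (t * h) \<noteq> 0"
proof -
  define a b c where "a = t - t ^ q ^ 3" and "b = t ^ q - t ^ q ^ 3" and "c = t ^ q ^ 2 - t ^ q ^ 3"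
  let ?S = "{z. a * z + b * z ^ q + c * z ^ q ^ 2 = 0}"
  \<comment> \<open>Otherwise \<open>t\<close> is fixed by the inverse of the Frobenius map, hence
    by the Frobenius map.\<close>
  have "a \<noteq> 0"
  proof
    assume "a = 0"
    then have *: "t ^ q ^ 3 = t"
      unfolding a_def right_minus_eq by (rule sym)
    have "t ^ q = (t ^ q ^ 3) ^ q"
      by (simp only: *)
    also have "\<dots> = t"
      by (rule frob_iterate)
    finally have "t ^ q = t" .
    from frob_fixed[OF this] assms show False
      by contradiction
  qed
  then have "card ?S \<le> q ^ 2"
    using card_linearized_roots_le[of a b c 0] by simp
  also have "\<dots> < q ^ 3"
    using q_gt_1 by (intro power_strict_increasing) auto
  finally have "card ?S < card {z. Tr z = 0}"
    unfolding card_ker_Tr .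
  then have "\<not> {z. Tr z = 0} \<subseteq> ?S"
    using card_mono[OF finite, of "{z. Tr z = 0}" ?S] by linarith
  then obtain h where h: "Tr h = 0" "h \<notin> ?S"
    by blast
  have "Tr (t * h) - t ^ q ^ 3 * Tr h = a * h + b * h ^ q + c * h ^ q ^ 2"
    by (simp add: Tr_def power_mult_distrib algebra_simps a_def b_def c_def)
  with h have "Tr (t * h) \<noteq> 0"
    by simp
  with h that show ?thesis
    by blast
qed

section \<open>Linear algebra over the small field inside the big one\<close>

text \<open>That entries span at least three dimensions over \<open>'k\<close> is expressed below by
  saying that no \<open>pspan\<close> contains them all.\<close>

definition pspan :: "'l \<Rightarrow> 'l \<Rightarrow> 'l set" where
  "pspan \<alpha> \<beta> = {\<iota> c * \<alpha> + \<iota> d * \<beta> | c d. True}"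

lemma card_pspan_le: "card (pspan \<alpha> \<beta>) \<le> q ^ 2"
proof -
  have "pspan \<alpha> \<beta> = (\<lambda>(c, d). \<iota> c * \<alpha> + \<iota> d * \<beta>) ` UNIV"
    by (auto simp: pspan_def)
  then show ?thesis
    using card_image_le[of "UNIV :: ('k \<times> 'k) set" "\<lambda>(c, d). \<iota> c * \<alpha> + \<iota> d * \<beta>"]
    by (simp add: card_k power2_eq_square flip: UNIV_Times_UNIV)
qed

lemma pspan_0: "0 \<in> pspan \<alpha> \<beta>"
  by (auto simp: pspan_def intro!: exI[of _ 0])

lemma pspan_add:
  assumes "x \<in> pspan \<alpha> \<beta>" "y \<in> pspan \<alpha> \<beta>"
  shows "x + y \<in> pspan \<alpha> \<beta>"
proof -
  obtain c d c' d' where "x = \<iota> c * \<alpha> + \<iota> d * \<beta>" "y = \<iota> c' * \<alpha> + \<iota> d' * \<beta>"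
    using assms by (auto simp: pspan_def)
  then have "x + y = \<iota> (c + c') * \<alpha> + \<iota> (d + d') * \<beta>"
    by (simp add: emb_add algebra_simps)
  then show ?thesis
    unfolding pspan_def by blast
qed

lemma pspan_scale:
  assumes "x \<in> pspan \<alpha> \<beta>"
  shows "\<iota> a * x \<in> pspan \<alpha> \<beta>"
proof -
  obtain c d where "x = \<iota> c * \<alpha> + \<iota> d * \<beta>"
    using assms by (auto simp: pspan_def)
  then have "\<iota> a * x = \<iota> (a * c) * \<alpha> + \<iota> (a * d) * \<beta>"
    by (simp add: emb_mult algebra_simps)
  then show ?thesis
    unfolding pspan_def by blast
qed

lemma pspan_sum:
  assumes "\<And>i. i \<in> A \<Longrightarrow> f i \<in> pspan \<alpha> \<beta>"
  shows "(\<Sum>i\<in>A. f i) \<in> pspan \<alpha> \<beta>"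
  using assms by (induction A rule: infinite_finite_induct) (auto simp: pspan_0 pspan_add)

text \<open>Stated for an indexed family rather than for its set of values, so that a repeated value
  counts as a dependence.\<close>

definition indep_over :: "'b set \<Rightarrow> ('b \<Rightarrow> 'l) \<Rightarrow> bool" where
  "indep_over B y \<longleftrightarrow> (\<forall>c. (\<Sum>b\<in>B. \<iota> (c b) * y b) = 0 \<longrightarrow> (\<forall>b\<in>B. c b = 0))"

lemma indep_overD:
  assumes "indep_over B y" and "(\<Sum>b\<in>B. \<iota> (c b) * y b) = 0" and "b \<in> B"
  shows "c b = 0"
  using assms unfolding indep_over_def by blast

text \<open>The \<open>q ^ 4\<close> coefficient families, taken as extensional functions on
  \<open>B\<close>, have distinct combinations, and the field has no more elements.\<close>

lemma indep_over_4_spans: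
  assumes "finite B" "card B = 4" "indep_over B y"
  obtains c where "z = (\<Sum>b\<in>B. \<iota> (c b) * y b)"
proof -
  let ?e = "\<lambda>c. \<Sum>b\<in>B. \<iota> (c b) * y b"
  have inj: "inj_on ?e (B \<rightarrow>\<^sub>E UNIV)"
  proof (rule inj_onI)
    fix c d assume cd: "c \<in> B \<rightarrow>\<^sub>E UNIV" "d \<in> B \<rightarrow>\<^sub>E UNIV" and "?e c = ?e d"
    then have "(\<Sum>b\<in>B. \<iota> (c b - d b) * y b) = 0"
      by (simp add: emb_diff left_diff_distrib sum_subtractf)
    then have "\<forall>b\<in>B. c b - d b = 0"
      using indep_overD[OF assms(3), of "\<lambda>b. c b - d b"] by blast
    with cd show "c = d"
      by (intro PiE_ext) auto
  qed
  have "card (?e ` (B \<rightarrow>\<^sub>E UNIV)) = CARD('l)"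
    using assms by (simp add: card_image[OF inj] card_PiE card_k card_l)
  then have "?e ` (B \<rightarrow>\<^sub>E UNIV) = UNIV"
    by (intro card_subset_eq) auto
  then have "z \<in> ?e ` (B \<rightarrow>\<^sub>E UNIV)"
    by simp
  then show ?thesis
    using that by (rule imageE)
qed

text \<open>The map \<open>z \<mapsto> a * z + b * z ^ q\<close> is linear over \<open>'k\<close>,
  so control on the basis \<open>y\<close> would force its whole image into a set of at most
  \<open>q ^ 2\<close> elements. Its fibres have at most \<open>q\<close> elements, so the image has
  at least \<open>q ^ 3\<close>.\<close>

lemma linearized_not_in_pspan:
  assumes "finite B" "card B = 4" "indep_over B y" and ab: "a \<noteq> 0 \<or> b \<noteq> 0"
  shows "\<not> (\<forall>i\<in>B. a * y i + b * y i ^ q \<in> pspan \<alpha> \<beta>)"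
proof
  assume *: "\<forall>i\<in>B. a * y i + b * y i ^ q \<in> pspan \<alpha> \<beta>"
  let ?f = "\<lambda>z. a * z + b * z ^ q"
  have "?f z \<in> pspan \<alpha> \<beta>" for z
  proof -
    obtain c where "z = (\<Sum>i\<in>B. \<iota> (c i) * y i)"
      using assms indep_over_4_spans by blast
    then have "?f z = (\<Sum>i\<in>B. \<iota> (c i) * ?f (y i))"
      by (simp add: frob_sum power_mult_distrib emb_frob1 sum_distrib_left sum.distrib
          distrib_left mult.left_commute)
    with * show ?thesis
      by (auto intro!: pspan_sum pspan_scale)
  qed
  then have "range ?f \<subseteq> pspan \<alpha> \<beta>"
    by auto
  then have "card (range ?f) \<le> q ^ 2"
    by (rule order.trans[OF card_mono[OF finite] card_pspan_le])
  moreover have "CARD('l) \<le> q * card (range ?f)"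
    using card_power_eq_linear_le[OF q_gt_1 ab] by (intro card_le_mult_card_image) auto
  ultimately have "q ^ 4 \<le> q * q ^ 2"
    unfolding card_l by (rule order.trans[OF _ mult_le_mono2, rotated])
  also have "q * q ^ 2 = q ^ 3"
    by (simp add: power2_eq_square power3_eq_cube)
  also have "\<dots> < q ^ 4"
    by (rule power_strict_increasing) (use q_gt_1 in simp_all)
  finally show False
    by simp
qed


section \<open>Coefficient vectors that no multiple of the relation brings into two
  dimensions\<close>

lemma frob_translate_rank_gt_2:
  assumes "finite B" "card B = 4" "indep_over B k"
  shows "\<not> (\<forall>b\<in>B. k b ^ q - \<theta> * k b \<in> pspan \<alpha> \<beta>)"
  using linearized_not_in_pspan[OF assms, of "- \<theta>" 1 \<alpha> \<beta>] by simp

text \<open>Up to a common factor, \<open>k\<close> is written as \<open>y ^ q - y\<close>. Then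
  \<open>y - \<theta> * k\<close> is a combination of \<open>y\<close> and \<open>y ^ q\<close>, and
  \<open>linearized_not_in_pspan\<close> applies once \<open>y\<close> is independent.\<close>

lemma exists_translate_rank_gt_2_of_rank_3:
  assumes "finite B" "card B = 4" "B0 \<subseteq> B" "card B0 = 3" and indep: "indep_over B0 k"
    and zero: "\<And>b. b \<in> B - B0 \<Longrightarrow> k b = 0"
  obtains x where "\<And>\<theta> \<alpha> \<beta>. \<not> (\<forall>b\<in>B. x b - \<theta> * k b \<in> pspan \<alpha> \<beta>)"
proof -
  have fin: "finite B0"
    using assms finite_subset by blast
  have "card (B - B0) = 1"
    using assms fin by (simp add: card_Diff_subset)
  then obtain b0 where b0: "B - B0 = {b0}"
    by (auto simp: card_1_singleton_iff)
  then have B: "B = insert b0 B0" "b0 \<notin> B0"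
    using assms(3) by auto
  \<comment> \<open>Three traces take at most \<open>q ^ 3\<close> values together, so they agree on
    two of the \<open>q ^ 4\<close> field elements; the difference of these is the factor
    \<open>\<mu>\<close>.\<close>
  let ?T = "\<lambda>\<delta>. \<lambda>b\<in>B0. Tr (\<delta> * k b)"
  have "?T ` UNIV \<subseteq> B0 \<rightarrow>\<^sub>E range \<iota>"
    using Tr_in_range by auto
  then have "card (range ?T) \<le> q ^ 3"
    using card_mono[of "B0 \<rightarrow>\<^sub>E range \<iota>" "range ?T"] fin
    by (simp add: finite_PiE card_PiE card_range_emb assms)
  also have "\<dots> < CARD('l)"
    using q_gt_1 by (simp add: card_l)
  finally have "\<not> inj ?T"
    by (auto dest: card_image)
  then obtain \<delta>1 \<delta>2 where \<delta>: "\<delta>1 \<noteq> \<delta>2" "?T \<delta>1 = ?T \<delta>2"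
    by (auto simp: inj_def)
  define \<mu> where "\<mu> = \<delta>1 - \<delta>2"
  have "\<mu> \<noteq> 0"
    using \<delta> by (simp add: \<mu>_def)
  have "\<exists>y. \<mu> * k b = y ^ q - y" if "b \<in> B0" for b
  proof -
    have "Tr (\<delta>1 * k b) = Tr (\<delta>2 * k b)"
      using fun_cong[OF \<delta>(2), of b] that by simp
    then have "Tr (\<mu> * k b) = 0"
      by (simp add: \<mu>_def left_diff_distrib Tr_diff)
    then show ?thesis
      by (metis additive_Hilbert_90)
  qed
  then obtain y0 where y0: "\<And>b. b \<in> B0 \<Longrightarrow> \<mu> * k b = y0 b ^ q - y0 b"
    by metis
  \<comment> \<open>At the index where \<open>k\<close> vanishes, \<open>y ^ q - y\<close> must be
    0; the value 1 achieves this and keeps \<open>y\<close> independent.\<close>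
  define y where "y = y0(b0 := 1)"
  have y: "\<mu> * k b = y b ^ q - y b" if "b \<in> B" for b
    using that B y0 zero by (auto simp: y_def)
  have "indep_over B y"
    unfolding indep_over_def
  proof (intro allI impI)
    fix c assume sum0: "(\<Sum>b\<in>B. \<iota> (c b) * y b) = 0"
    \<comment> \<open>Applying \<open>z \<mapsto> z ^ q - z\<close> to the relation removes the
      entry 1 and turns the others into multiples of \<open>k\<close>.\<close>
    have "0 = (\<Sum>b\<in>B. \<iota> (c b) * y b) ^ q - (\<Sum>b\<in>B. \<iota> (c b) * y b)"
      using q_gt_1 sum0 by simp
    also have "\<dots> = (\<Sum>b\<in>B. \<iota> (c b) * (y b ^ q - y b))"
      by (simp add: frob_sum power_mult_distrib emb_frob1 right_diff_distrib sum_subtractf)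
    also have "\<dots> = (\<Sum>b\<in>B. \<mu> * (\<iota> (c b) * k b))"
      by (rule sum.cong) (simp_all add: mult.left_commute flip: y)
    also have "\<dots> = \<mu> * (\<Sum>b\<in>B0. \<iota> (c b) * k b)"
      using B fin zero by (simp add: sum_distrib_left)
    finally have "(\<Sum>b\<in>B0. \<iota> (c b) * k b) = 0"
      using \<open>\<mu> \<noteq> 0\<close> by simp
    then have c0: "c b = 0" if "b \<in> B0" for b
      using indep_overD[OF indep, of c b] that by simp
    then have "c b0 = 0"
      using sum0 B fin by (simp add: y_def)
    with c0 B show "\<forall>b\<in>B. c b = 0"
      by auto
  qed
  show ?thesis
  proof (rule that)
    fix \<theta> \<alpha> \<beta>
    have "y b - \<theta> * k b = (1 + \<theta> / \<mu>) * y b + (- \<theta> / \<mu>) * y b ^ q" if "b \<in> B" for b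
    proof -
      have k: "k b = (y b ^ q - y b) / \<mu>"
        using y[OF that] \<open>\<mu> \<noteq> 0\<close> by (simp add: field_simps)
      show ?thesis
        unfolding k by (simp add: algebra_simps diff_divide_distrib)
    qed
    \<comment> \<open>The two coefficients add up to 1.\<close>
    moreover have "1 + \<theta> / \<mu> \<noteq> 0 \<or> - \<theta> / \<mu> \<noteq> 0"
      by auto
    from linearized_not_in_pspan[OF assms(1,2) \<open>indep_over B y\<close> this]
    have "\<not> (\<forall>b\<in>B. (1 + \<theta> / \<mu>) * y b + (- \<theta> / \<mu>) * y b ^ q \<in> pspan \<alpha> \<beta>)" .
    ultimately show "\<not> (\<forall>b\<in>B. y b - \<theta> * k b \<in> pspan \<alpha> \<beta>)"
      by (simp cong: ball_cong)
  qed
qed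

text \<open>No \<open>pspan\<close> has more than \<open>q ^ 2\<close> elements, and
  \<open>pspan 1 t\<close> attains this bound because \<open>t\<close> is outside the
  subfield.\<close>

lemma pspan_eqI:
  assumes "1 \<in> pspan \<alpha> \<beta>" "t \<in> pspan \<alpha> \<beta>" and t: "t \<notin> range \<iota>"
  shows "pspan \<alpha> \<beta> = pspan 1 t"
proof -
  let ?f = "\<lambda>(c, d). \<iota> c * 1 + \<iota> d * t"
  have "inj ?f"
  proof (rule injI, clarify)
    fix c d c' d' assume "\<iota> c * 1 + \<iota> d * t = \<iota> c' * 1 + \<iota> d' * t"
    then have eq: "\<iota> (d - d') * t = \<iota> (c' - c)"
      by (simp add: emb_diff algebra_simps)
    have "d = d'"
    proof (rule ccontr)
      assume "d \<noteq> d'"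
      with eq have "t = \<iota> ((c' - c) / (d - d'))"
        unfolding emb_divide by (metis emb_eq_0 nonzero_mult_div_cancel_left right_minus_eq)
      with t show False
        by blast
    qed
    with eq show "c = c' \<and> d = d'"
      by simp
  qed
  moreover have range: "pspan 1 t = range ?f"
    by (auto simp: pspan_def)
  ultimately have "card (pspan 1 t) = q ^ 2"
    by (simp add: card_image card_k power2_eq_square flip: UNIV_Times_UNIV)
  moreover have sub: "pspan 1 t \<subseteq> pspan \<alpha> \<beta>"
    unfolding range using assms by (auto intro!: pspan_add pspan_scale simp del: mult_1_right)
  ultimately show ?thesis
    using card_pspan_le[of \<alpha> \<beta>] card_mono[OF finite sub] card_subset_eq[OF finite sub] by simp
qed

text \<open>The entries where \<open>k\<close> vanishes do not move with \<open>\<theta>\<close>;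
  chosen as 1 and \<open>t\<close>, they force the plane to be \<open>pspan 1 t\<close>. The other
  two entries are linked by \<open>k b2 = t * k b1\<close>.\<close>

lemma exists_translate_rank_gt_2_of_rank_2:
  assumes "finite B" "card B = 4" "B0 \<subseteq> B" "card B0 = 2" and indep: "indep_over B0 k"
    and zero: "\<And>b. b \<in> B - B0 \<Longrightarrow> k b = 0"
  obtains x where "\<And>\<theta> \<alpha> \<beta>. \<not> (\<forall>b\<in>B. x b - \<theta> * k b \<in> pspan \<alpha> \<beta>)"
proof -
  have "card (B - B0) = 2"
    using assms finite_subset[OF assms(3)] by (simp add: card_Diff_subset)
  then obtain b3 b4 where b34: "B - B0 = {b3, b4}" "b3 \<noteq> b4"
    by (auto simp: card_2_iff)
  obtain b1 b2 where b12: "B0 = {b1, b2}" "b1 \<noteq> b2"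
    using assms(4) by (auto simp: card_2_iff)
  have B: "B = {b1, b2, b3, b4}" "distinct [b1, b2, b3, b4]"
    using b12 b34 assms(3) by auto
  have k12: "c = 0 \<and> d = 0" if "\<iota> c * k b1 + \<iota> d * k b2 = 0" for c d
    using indep_overD[OF indep, of "\<lambda>b. if b = b1 then c else d" b1]
      indep_overD[OF indep, of "\<lambda>b. if b = b1 then c else d" b2] that b12 by auto
  have k1: "k b1 \<noteq> 0" and k2: "k b2 \<noteq> 0"
    using k12[of 1 0] k12[of 0 1] by auto
  define t where "t = k b2 / k b1"
  have "t \<noteq> 0"
    using k1 k2 by (simp add: t_def)
  have t: "t \<notin> range \<iota>"
  proof
    assume "t \<in> range \<iota>"
    then obtain c where "k b2 = \<iota> c * k b1"
      using k1 by (auto simp: t_def field_simps)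
    with k12[of "- c" 1] show False
      by (simp add: emb_uminus)
  qed
  \<comment> \<open>The range of \<open>?g\<close> collects the values of \<open>s\<close> to be
    avoided; it has at most \<open>q ^ 3\<close> elements.\<close>
  let ?g = "\<lambda>(c, d, e). \<iota> c * 1 + \<iota> d * t + \<iota> e / t"
  have "card (range ?g) \<le> CARD('k \<times> 'k \<times> 'k)"
    by (rule card_image_le) simp
  also have "\<dots> = q ^ 3"
    by (simp add: card_k power3_eq_cube flip: UNIV_Times_UNIV)
  also have "\<dots> < CARD('l)"
    using q_gt_1 by (simp add: card_l)
  finally have "range ?g \<noteq> UNIV"
    by auto
  then obtain s where s: "s \<notin> range ?g"
    using top.not_eq_extremum[of "range ?g"] psubset_imp_ex_mem[of "range ?g" UNIV] by auto
  define x where "x b = (if b = b1 then s else if b = b2 then 0 else if b = b3 then 1 else t)" for b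
  have x: "x b1 = s" "x b2 = 0" "x b3 = 1" "x b4 = t"
    using B(2) by (auto simp: x_def)
  have mem: "b1 \<in> B" "b2 \<in> B" "b3 \<in> B" "b4 \<in> B"
    unfolding B(1) by simp_all
  have k34: "k b3 = 0" "k b4 = 0"
    using zero b34(1) by simp_all
  show ?thesis
  proof (rule that, rule notI)
    fix \<theta> \<alpha> \<beta> assume *: "\<forall>b\<in>B. x b - \<theta> * k b \<in> pspan \<alpha> \<beta>"
    have "1 \<in> pspan \<alpha> \<beta>"
      using bspec[OF * mem(3)] by (simp add: x k34)
    moreover have "t \<in> pspan \<alpha> \<beta>"
      using bspec[OF * mem(4)] by (simp add: x k34)
    ultimately have eq: "pspan \<alpha> \<beta> = pspan 1 t"
      by (rule pspan_eqI[OF _ _ t])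
    obtain c d where cd: "s - \<theta> * k b1 = \<iota> c * 1 + \<iota> d * t"
      using bspec[OF * mem(1)] unfolding eq x unfolding pspan_def by blast
    obtain c' d' where cd': "- \<theta> * k b2 = \<iota> c' * 1 + \<iota> d' * t"
      using bspec[OF * mem(2)] unfolding eq x unfolding pspan_def by auto
    \<comment> \<open>The entry 0 at \<open>b2\<close> puts \<open>\<theta> * k b2\<close> into
      \<open>pspan 1 t\<close>. Division by \<open>t\<close> puts \<open>\<theta> * k b1\<close>
      into the span of 1 and \<open>1 / t\<close>.\<close>
    have "\<theta> * k b1 = - (- \<theta> * k b2) / t"
      using k1 k2 by (simp add: t_def)
    also have "\<dots> = - (\<iota> c' / t) - \<iota> d'"
      unfolding cd' using \<open>t \<noteq> 0\<close> by (simp add: field_simps)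
    finally have k1_eq: "\<theta> * k b1 = - (\<iota> c' / t) - \<iota> d'" .
    have "s = (\<iota> c * 1 + \<iota> d * t) + \<theta> * k b1"
      unfolding cd[symmetric] by simp
    also have "\<dots> = \<iota> (c - d') * 1 + \<iota> d * t + \<iota> (- c') / t"
      unfolding k1_eq by (simp add: emb_diff emb_uminus)
    finally have "s = \<iota> (c - d') * 1 + \<iota> d * t + \<iota> (- c') / t" .
    then have "s = ?g (c - d', d, - c')"
      by simp
    then have "s \<in> range ?g"
      by (rule range_eqI)
    with s show False
      by contradiction
  qed
qed

end

section \<open>Lower bound: rank at most 4 does not suffice\<close>

text \<open>Distinct points of the secant line come from independent vectors, which therefore span
  the line.\<close>

lemma one_saturatingD:
  fixes U :: "('l::field^'n) set"
  assumes "one_saturating (linear_set U)" and "p \<noteq> 0"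
  shows "\<exists>u\<in>U. \<exists>v\<in>U. \<exists>\<alpha> \<beta>. p = \<alpha> *s u + \<beta> *s v"
proof -
  have "pg_point (vec.span {p})"
    using assms(2) by (simp add: pg_point_def)
  then obtain l where l: "secant_line (linear_set U) l" "vec.span {p} \<subseteq> l"
    using assms(1) unfolding one_saturating_def by blast
  then obtain u v where uv: "u \<in> U" "v \<in> U" "u \<noteq> 0" "v \<noteq> 0" "vec.span {u} \<noteq> vec.span {v}"
      "vec.span {u} \<subseteq> l" "vec.span {v} \<subseteq> l" and "pg_line l"
    unfolding secant_line_def linear_set_def by blast
  have mem: "u \<in> l" "v \<in> l" "p \<in> l"
    using uv l vec.span_base by blast+
  have "u \<notin> vec.span {v}"
  proof
    assume u: "u \<in> vec.span {v}"
    have "v \<in> vec.span {u}"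
      using vec.in_span_insert[of u v "{}"] u uv by simp
    with u have "vec.span {u} = vec.span {v}"
      by (intro equalityI vec.span_minimal) auto
    with uv show False by simp
  qed
  then have "vec.independent {u, v}" "u \<noteq> v"
    using uv vec.span_base[of v "{v}"] by (auto simp: vec.independent_insert)
  then have "l \<subseteq> vec.span {u, v}"
    using mem \<open>pg_line l\<close> by (intro vec.card_ge_dim_independent) (auto simp: pg_line_def)
  then obtain \<alpha> where "p - \<alpha> *s u \<in> vec.span {v}"
    using mem vec.span_breakdown_eq by blast
  then obtain \<beta> where "p - \<alpha> *s u = \<beta> *s v"
    unfolding vec.span_singleton by blast
  then have "p = \<alpha> *s u + \<beta> *s v"
    by (simp add: algebra_simps)
  with uv show ?thesis
    by blast
qed

context quartic_extension
begin

sublocale kv: vector_space "restrict_scale \<iota> :: 'k \<Rightarrow> 'l^3 \<Rightarrow> 'l^3"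
  by (rule vector_space_restrict_scale[OF embedding])

lemma card_kspan:
  assumes "kv.independent B"
  shows "card (kv.span B) = q ^ card B"
proof -
  let ?e = "\<lambda>c. \<Sum>b\<in>B. restrict_scale \<iota> (c b) b"
  have inj: "inj_on ?e (B \<rightarrow>\<^sub>E UNIV)"
  proof (rule inj_onI)
    fix c d assume cd: "c \<in> B \<rightarrow>\<^sub>E UNIV" "d \<in> B \<rightarrow>\<^sub>E UNIV" and "?e c = ?e d"
    then have "(\<Sum>b\<in>B. restrict_scale \<iota> (c b - d b) b) = 0"
      by (simp add: kv.scale_left_diff_distrib sum_subtractf)
    then have "\<forall>b\<in>B. c b - d b = 0"
      using kv.independentD[OF assms finite subset_refl, of "\<lambda>b. c b - d b"] by blast
    with cd show "c = d"
      by (intro PiE_ext) auto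
  qed
  have "kv.span B = ?e ` (B \<rightarrow>\<^sub>E UNIV)"
  proof -
    have "?e c \<in> ?e ` (B \<rightarrow>\<^sub>E UNIV)" for c
    proof (rule image_eqI)
      show "?e c = ?e (restrict c B)"
        by (rule sum.cong) auto
    qed auto
    then show ?thesis
      unfolding kv.span_finite[OF finite] by blast
  qed
  then show ?thesis
    by (simp add: card_image[OF inj] card_PiE[OF finite] card_k)
qed

text \<open>Reading dimensions off cardinalities spares an explicit basis of the trace-zero elements
  later.\<close>

lemma card_subspace:
  assumes "kv.subspace U"
  shows "card U = q ^ kv.dim U"
proof -
  obtain B where B: "B \<subseteq> U" "kv.independent B" "U \<subseteq> kv.span B" "card B = kv.dim U"
    by (rule kv.basis_exists)
  then have "kv.span B = U"
    using assms by (intro equalityI kv.span_minimal) auto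
  with B card_kspan show ?thesis
    by metis
qed

lemma kspan_subset_span: "kv.span S \<subseteq> vec.span S"
proof (rule kv.span_minimal)
  show "kv.subspace (vec.span S)"
    by (auto simp: kv.subspace_def restrict_scale_def vec.span_zero vec.span_add vec.span_scale)
qed (auto intro: vec.span_base)

text \<open>\<open>B\<close> need not generate \<open>U\<close>: its size is left free so that it
  can be minimized.\<close>

definition extension_dependency :: "('l^3) set \<Rightarrow> ('l^3) set \<Rightarrow> ('l^3 \<Rightarrow> 'l) \<Rightarrow> bool" where
  "extension_dependency U B k \<longleftrightarrow> B \<subseteq> U \<and> kv.independent B \<and>
     (\<Sum>b\<in>B. k b *s b) = 0 \<and> (\<exists>b\<in>B. k b \<noteq> 0)"

text \<open>A nontrivial relation \<open>c\<close> over \<open>'k\<close> among the coefficients can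
  be solved for some \<open>k a\<close>. Substituting this absorbs \<open>a\<close> into the other
  vectors and leaves a dependency with one vector fewer.\<close>

lemma minimal_dependency_indep_over:
  assumes U: "kv.subspace U" and dep: "extension_dependency U B k"
    and min: "\<And>B' k'. extension_dependency U B' k' \<Longrightarrow> card B \<le> card B'"
  shows "indep_over B k"
  unfolding indep_over_def
proof (intro allI impI, rule ccontr)
  fix c assume c0: "(\<Sum>b\<in>B. \<iota> (c b) * k b) = 0" and "\<not> (\<forall>b\<in>B. c b = 0)"
  then obtain a where a: "a \<in> B" "c a \<noteq> 0"
    by blast
  define C where "C = B - {a}"
  define h where "h b = b - restrict_scale \<iota> (c b / c a) a" for b
  have B: "B = insert a C" "a \<notin> C"
    using a by (auto simp: C_def)
  have indep_C: "\<forall>b\<in>C. d b = 0" if "(\<Sum>b\<in>C. restrict_scale \<iota> (d b) (h b)) = 0" for d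
  proof -
    \<comment> \<open>These are the coefficients with respect to \<open>B\<close> of a combination
      of the \<open>h b\<close>; all multiples of \<open>a\<close> are collected at
      \<open>a\<close>.\<close>
    define e where "e b = (if b = a then - (\<Sum>b\<in>C. d b * (c b / c a)) else d b)" for b
    have "(\<Sum>b\<in>C. restrict_scale \<iota> (e b) b) = (\<Sum>b\<in>C. restrict_scale \<iota> (d b) b)"
      using B by (intro sum.cong) (auto simp: e_def)
    then have "(\<Sum>b\<in>B. restrict_scale \<iota> (e b) b)
        = (\<Sum>b\<in>C. restrict_scale \<iota> (d b) b) - (\<Sum>b\<in>C. restrict_scale \<iota> (d b * (c b / c a)) a)"
      using B by (simp add: e_def kv.scale_sum_left)
    also have "\<dots> = (\<Sum>b\<in>C. restrict_scale \<iota> (d b) (h b))"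
      by (simp add: h_def kv.scale_right_diff_distrib sum_subtractf)
    finally have "(\<Sum>b\<in>B. restrict_scale \<iota> (e b) b) = 0"
      using that by simp
    then have "\<forall>b\<in>B. e b = 0"
      using kv.independentD[OF _ finite subset_refl, of B e] dep
      by (simp add: extension_dependency_def)
    with B show ?thesis
      by (auto simp: e_def split: if_splits)
  qed
  have inj: "inj_on h C"
  proof (rule inj_onI, rule ccontr)
    fix b b' assume b: "b \<in> C" "b' \<in> C" "h b = h b'" "b \<noteq> b'"
    let ?d = "\<lambda>x. if x = b then 1 else if x = b' then - 1 else 0"
    have "(\<Sum>x\<in>C. restrict_scale \<iota> (?d x) (h x)) = (\<Sum>x\<in>{b, b'}. restrict_scale \<iota> (?d x) (h x))"
      using b by (intro sum.mono_neutral_right) auto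
    also have "\<dots> = 0"
      using b by simp
    finally show False
      using indep_C[of ?d] b(1) by auto
  qed
  have "kv.independent (h ` C)"
  proof (rule kv.independent_if_scalars_zero[OF finite])
    fix f x assume "(\<Sum>x\<in>h ` C. restrict_scale \<iota> (f x) x) = 0" "x \<in> h ` C"
    with indep_C[of "f \<circ> h"] show "f x = 0"
      by (auto simp: sum.reindex[OF inj])
  qed
  moreover have "h ` C \<subseteq> U"
  proof -
    have "B \<subseteq> U"
      using dep by (simp add: extension_dependency_def)
    then show ?thesis
      using a U by (auto simp: h_def C_def intro!: kv.subspace_diff kv.subspace_scale)
  qed
  moreover have sum_C: "(\<Sum>b\<in>C. k b *s h b) = 0"
  proof -
    have "k a = - (\<Sum>b\<in>C. \<iota> (c b) * k b) / \<iota> (c a)"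
      using c0 a B by (simp add: field_simps eq_neg_iff_add_eq_0)
    also have "\<dots> = - (\<Sum>b\<in>C. k b * \<iota> (c b / c a))"
      by (simp add: emb_divide sum_divide_distrib mult.commute)
    finally have ka: "k a = - (\<Sum>b\<in>C. k b * \<iota> (c b / c a))" .
    have "(\<Sum>b\<in>C. k b *s h b) = (\<Sum>b\<in>C. k b *s b) - (\<Sum>b\<in>C. k b * \<iota> (c b / c a)) *s a"
      by (simp add: h_def restrict_scale_def vec.scale_right_diff_distrib sum_subtractf
          vec.scale_sum_left)
    also have "\<dots> = (\<Sum>b\<in>B. k b *s b)"
      using B by (simp add: ka)
    finally show ?thesis
      using dep by (simp add: extension_dependency_def)
  qed
  moreover have "\<exists>b\<in>C. k b \<noteq> 0"
  proof (rule ccontr)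
    assume *: "\<not> (\<exists>b\<in>C. k b \<noteq> 0)"
    then have "k a = 0"
      using c0 a B by simp
    with * B dep show False
      by (auto simp: extension_dependency_def)
  qed
  \<comment> \<open>The vectors are now the values of \<open>h\<close>, so the coefficients are
    carried over by its inverse on \<open>C\<close>.\<close>
  ultimately have "extension_dependency U (h ` C) (k \<circ> the_inv_into C h)"
    unfolding extension_dependency_def
    by (auto simp: sum.reindex[OF inj] the_inv_into_f_f[OF inj] cong: sum.cong)
  from min[OF this] have "card B \<le> card C"
    by (simp add: card_image[OF inj])
  then show False
    using B by simp
qed

text \<open>If \<open>B\<close> does not span over \<open>'l\<close>, any vector outside its span
  will do. Otherwise the length of a shortest dependency decides which construction of
  \<open>x\<close> applies.\<close>

lemma exists_uncovered_vector:
  assumes "kv.independent B" and "card B = 4"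
  obtains p where "\<And>u v \<alpha> \<beta>. u \<in> kv.span B \<Longrightarrow> v \<in> kv.span B \<Longrightarrow> p \<noteq> \<alpha> *s u + \<beta> *s v"
proof (cases "vec.span B = UNIV")
  case False
  then obtain p where "p \<notin> vec.span B"
    by blast
  then show ?thesis
    using kspan_subset_span[of B] by (intro that[of p]) (auto intro: vec.span_add vec.span_scale)
next
  case True
  let ?U = "kv.span B"
  \<comment> \<open>Four vectors in a three-dimensional space.\<close>
  have "vec.dependent B"
    using vec.independent_card_le_dim[of B UNIV] assms(2) by (auto simp: card_cart_basis)
  then obtain k0 where "extension_dependency ?U B k0"
    using assms(1) kv.span_superset
    unfolding extension_dependency_def vec.dependent_finite[OF finite] by blast
  then have ex: "\<exists>r B0 k. extension_dependency ?U B0 k \<and> card B0 = r"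
    by blast
  define r where "r = (LEAST r. \<exists>B0 k. extension_dependency ?U B0 k \<and> card B0 = r)"
  obtain B0 k where dep: "extension_dependency ?U B0 k" and r: "card B0 = r"
    using LeastI_ex[OF ex] unfolding r_def by blast
  have min: "card B0 \<le> card B'" if "extension_dependency ?U B' k'" for B' k'
    unfolding r unfolding r_def using that by (intro Least_le) blast
  have indep: "indep_over B0 k"
    by (rule minimal_dependency_indep_over[OF kv.subspace_span dep min])
  have B0: "B0 \<subseteq> ?U" "kv.independent B0" "(\<Sum>b\<in>B0. k b *s b) = 0"
    using dep by (auto simp: extension_dependency_def)
  obtain b0 where b0: "b0 \<in> B0" "k b0 \<noteq> 0"
    using dep by (auto simp: extension_dependency_def)
  obtain E where E: "B0 \<subseteq> E" "E \<subseteq> ?U" "kv.independent E" "?U \<subseteq> kv.span E"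
    using kv.maximal_independent_subset_extend[OF B0(1,2)] .
  have span_E: "kv.span E = ?U"
    using kv.span_minimal[OF E(2) kv.subspace_span] E(4) by (rule equalityI)
  have card_E: "card E = 4"
    using kv.dim_span_eq_card_independent[OF E(3)] kv.dim_span_eq_card_independent[OF assms(1)]
      assms(2) by (simp add: span_E)
  have "B \<subseteq> vec.span E"
    using kv.span_superset[of B] kspan_subset_span[of E] span_E by blast
  then have "vec.span B \<subseteq> vec.span E"
    by (rule vec.span_minimal) simp
  then have span_E': "vec.span E = UNIV"
    using True by blast
  \<comment> \<open>Values of \<open>k\<close> outside \<open>B0\<close> are arbitrary; setting them
    to 0 gives a relation on the whole basis \<open>E\<close>.\<close>
  define m where "m b = (if b \<in> B0 then k b else 0)" for b
  have indep_m: "indep_over B0 m"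
    using indep unfolding indep_over_def by (simp add: m_def cong: sum.cong)
  have m0: "m b = 0" if "b \<in> E - B0" for b
    using that by (simp add: m_def)
  have "card B0 \<noteq> 0"
    using b0 by auto
  moreover have "card B0 \<noteq> 1"
  proof
    assume "card B0 = 1"
    then have "B0 = {b0}"
      using b0 by (auto simp: card_1_singleton_iff)
    with b0 B0 show False
      by simp
  qed
  moreover have "card B0 \<le> 4"
    using card_mono[OF finite E(1)] card_E by simp
  ultimately consider "card B0 = 2" | "card B0 = 3" | "card B0 = 4"
    by linarith
  then obtain x where x: "\<And>\<theta> \<alpha> \<beta>. \<not> (\<forall>b\<in>E. x b - \<theta> * m b \<in> pspan \<alpha> \<beta>)"
  proof cases
    case 1
    from exists_translate_rank_gt_2_of_rank_2[OF finite card_E E(1) 1 indep_m m0] that show ?thesis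
      by blast
  next
    case 2
    from exists_translate_rank_gt_2_of_rank_3[OF finite card_E E(1) 2 indep_m m0] that show ?thesis
      by blast
  next
    case 3
    then have "B0 = E"
      using card_subset_eq[OF finite E(1)] card_E by simp
    with frob_translate_rank_gt_2[OF finite card_E, of m] indep_m show ?thesis
      by (intro that[of "\<lambda>b. m b ^ q"]) simp
  qed
  have sum_m: "(\<Sum>b\<in>E. m b *s b) = 0"
  proof -
    have "(\<Sum>b\<in>E. m b *s b) = (\<Sum>b\<in>B0. k b *s b)"
      using E(1) by (intro sum.mono_neutral_cong_right) (auto simp: m_def)
    with B0 show ?thesis by simp
  qed
  \<comment> \<open>Since \<open>m b0\<close> is nonzero, the three vectors of \<open>C\<close>
    still span over \<open>'l\<close> and so form a basis. A relation on \<open>E\<close> is thus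
    determined by its coefficient at \<open>b0\<close>.\<close>
  define C where "C = E - {b0}"
  have EC: "E = insert b0 C" "b0 \<notin> C"
    using b0 E by (auto simp: C_def)
  have mb0: "m b0 \<noteq> 0"
    using b0 by (simp add: m_def)
  have "m b0 *s b0 + (\<Sum>b\<in>C. m b *s b) = 0"
    using sum_m EC by simp
  then have "m b0 *s b0 = - (\<Sum>b\<in>C. m b *s b)"
    by (simp add: eq_neg_iff_add_eq_0)
  then have "inverse (m b0) *s (m b0 *s b0) = inverse (m b0) *s (- (\<Sum>b\<in>C. m b *s b))"
    by simp
  then have "b0 = inverse (m b0) *s (- (\<Sum>b\<in>C. m b *s b))"
    using mb0 by simp
  also have "\<dots> \<in> vec.span C"
    by (intro vec.span_scale vec.span_neg vec.span_sum) (auto intro: vec.span_base)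
  finally have "vec.span C = UNIV"
    using vec.span_redundant[of b0 C] span_E' EC by simp
  moreover have "card C = 3"
    using card_E EC by simp
  ultimately have indep_C: "vec.independent C"
    by (intro vec.card_le_dim_spanning[of C UNIV]) (auto simp: card_cart_basis)
  show ?thesis
  proof (rule that[of "\<Sum>b\<in>E. x b *s b"], rule notI)
    fix u v \<alpha> \<beta> assume "u \<in> ?U" "v \<in> ?U"
      and eq: "(\<Sum>b\<in>E. x b *s b) = \<alpha> *s u + \<beta> *s v"
    then obtain c d where cd: "u = (\<Sum>b\<in>E. restrict_scale \<iota> (c b) b)"
        "v = (\<Sum>b\<in>E. restrict_scale \<iota> (d b) b)"
      unfolding span_E[symmetric] unfolding kv.span_finite[OF finite] by blast
    define w where "w b = x b - (\<iota> (c b) * \<alpha> + \<iota> (d b) * \<beta>)" for b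
    have sum_w: "(\<Sum>b\<in>E. w b *s b) = 0"
      using eq unfolding cd
      by (simp add: w_def restrict_scale_def vec.scale_left_diff_distrib vec.scale_left_distrib
          vec.scale_sum_right sum_subtractf sum.distrib mult.commute)
    \<comment> \<open>This factor makes \<open>w\<close> and \<open>\<theta> * m\<close> agree at
      \<open>b0\<close>, hence on all of \<open>E\<close>.\<close>
    define \<theta> where "\<theta> = w b0 / m b0"
    have "(\<Sum>b\<in>E. (w b - \<theta> * m b) *s b) = (\<Sum>b\<in>E. w b *s b) - \<theta> *s (\<Sum>b\<in>E. m b *s b)"
      by (simp add: vec.scale_left_diff_distrib sum_subtractf vec.scale_sum_right)
    then have "(\<Sum>b\<in>E. (w b - \<theta> * m b) *s b) = 0"
      using sum_w sum_m by simp
    moreover have wb0: "w b0 - \<theta> * m b0 = 0"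
      using mb0 by (simp add: \<theta>_def)
    ultimately have "(\<Sum>b\<in>C. (w b - \<theta> * m b) *s b) = 0"
      using EC by simp
    then have "\<forall>b\<in>C. w b - \<theta> * m b = 0"
      using vec.independentD[OF indep_C finite subset_refl, of "\<lambda>b. w b - \<theta> * m b"] by blast
    with wb0 EC have "\<forall>b\<in>E. w b - \<theta> * m b = 0"
      by simp
    then have "\<forall>b\<in>E. x b - \<theta> * m b = \<iota> (c b) * \<alpha> + \<iota> (d b) * \<beta>"
      by (simp add: w_def algebra_simps)
    then have "\<forall>b\<in>E. x b - \<theta> * m b \<in> pspan \<alpha> \<beta>"
      unfolding pspan_def by blast
    with x show False
      by blast
  qed
qed

text \<open>A subspace of dimension below 5 lies in one of dimension exactly 4, and a vector missed
  by the larger one is missed by the smaller.\<close>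

lemma saturating_dim_ge:
  assumes U: "kv.subspace U" and sat: "one_saturating (linear_set U)"
  shows "5 \<le> kv.dim U"
proof (rule ccontr)
  assume "\<not> 5 \<le> kv.dim U"
  obtain B where B: "B \<subseteq> U" "kv.independent B" "U \<subseteq> kv.span B" "card B = kv.dim U"
    by (rule kv.basis_exists)
  obtain E where E: "B \<subseteq> E" "kv.independent E" "UNIV \<subseteq> kv.span E"
    using kv.maximal_independent_subset_extend[OF subset_UNIV B(2)] by metis
  \<comment> \<open>The whole space has \<open>(q ^ 4) ^ 3\<close> elements, which leaves room to
    enlarge \<open>B\<close> to four vectors.\<close>
  have "q ^ card E = q ^ 12"
    using card_kspan[OF E(2)] E(3) card_l by (simp add: top.extremum_unique flip: power_mult)
  then have "card E = 12"
    using q_gt_1 by simp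
  then obtain B' where B': "B \<subseteq> B'" "B' \<subseteq> E" "card B' = 4"
    using exists_subset_between[OF _ _ E(1) finite, of 4] B(4) \<open>\<not> 5 \<le> kv.dim U\<close> by auto
  have "kv.independent B'"
    using E(2) B'(2) by (rule kv.independent_mono)
  then obtain p where p: "\<And>u v \<alpha> \<beta>. u \<in> kv.span B' \<Longrightarrow> v \<in> kv.span B' \<Longrightarrow> p \<noteq> \<alpha> *s u + \<beta> *s v"
    using exists_uncovered_vector B'(3) by blast
  have "p \<noteq> 0"
    using p[of 0 0 0 0] kv.span_zero by auto
  have "U \<subseteq> kv.span B'"
    using B(3) kv.span_mono[OF B'(1)] by blast
  with one_saturatingD[OF sat \<open>p \<noteq> 0\<close>] p show False
    by blast
qed

end

section \<open>Upper bound: a saturating linear set of rank 5\<close>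

lemma one_saturatingI:
  fixes U :: "('l::field^'n) set"
  assumes "\<And>p. p \<noteq> 0 \<Longrightarrow>
    \<exists>u\<in>U. \<exists>v\<in>U. u \<noteq> 0 \<and> v \<notin> vec.span {u} \<and> (\<exists>\<alpha> \<beta>. p = \<alpha> *s u + \<beta> *s v)"
  shows "one_saturating (linear_set U)"
  unfolding one_saturating_def
proof (intro allI impI)
  fix P :: "('l^'n) set" assume P: "pg_point P"
  obtain B where B: "B \<subseteq> P" "vec.independent B" "P \<subseteq> vec.span B" "card B = vec.dim P"
    by (rule vec.basis_exists)
  then obtain p where p: "B = {p}"
    using P by (auto simp: pg_point_def card_1_singleton_iff)
  then have "p \<noteq> 0"
    using B by auto
  then obtain u v \<alpha> \<beta> where uv: "u \<in> U" "v \<in> U" "u \<noteq> 0" "v \<notin> vec.span {u}"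
      and p_eq: "p = \<alpha> *s u + \<beta> *s v"
    using assms by meson
  let ?l = "vec.span {v, u}"
  have "v \<noteq> u" "v \<noteq> 0"
    using uv vec.span_base[of u "{u}"] vec.span_zero by auto
  then have "vec.independent {v, u}"
    using uv by (simp add: vec.independent_insert)
  then have "pg_line ?l"
    using \<open>v \<noteq> u\<close> vec.dim_span_eq_card_independent[of "{v, u}"] by (simp add: pg_line_def)
  moreover have "vec.span {u} \<noteq> vec.span {v}"
    using uv vec.span_base[of v "{v}"] by auto
  moreover have "vec.span {u} \<in> linear_set U" "vec.span {v} \<in> linear_set U"
    using uv \<open>v \<noteq> 0\<close> by (auto simp: linear_set_def)
  moreover have "vec.span {u} \<subseteq> ?l" "vec.span {v} \<subseteq> ?l"
    by (rule vec.span_mono, simp)+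
  ultimately have "secant_line (linear_set U) ?l"
    unfolding secant_line_def by blast
  moreover have "p \<in> ?l"
    unfolding p_eq by (intro vec.span_add vec.span_scale) (auto intro: vec.span_base)
  then have "P \<subseteq> ?l"
    using B p vec.span_minimal[of "{p}" ?l] by auto
  ultimately show "\<exists>l. secant_line (linear_set U) l \<and> P \<subseteq> l"
    by blast
qed

context quartic_extension
begin

definition trace_cone :: "('l^3) set" where
  "trace_cone = {vector [z, \<iota> a, \<iota> b] | z a b. Tr z = 0}"

lemma trace_coneI: "Tr z = 0 \<Longrightarrow> vector [z, \<iota> a, \<iota> b] \<in> trace_cone"
  by (auto simp: trace_cone_def)

lemma subspace_trace_cone: "kv.subspace trace_cone"
  unfolding kv.subspace_def
proof (intro conjI ballI allI)
  show "0 \<in> trace_cone"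
    unfolding trace_cone_def
    by (rule CollectI, intro exI[of _ 0]) (simp add: vec_eq_iff forall_3)
next
  fix x y assume "x \<in> trace_cone" "y \<in> trace_cone"
  then obtain z a b z' a' b' where xy: "x = vector [z, \<iota> a, \<iota> b]" "Tr z = 0"
      "y = vector [z', \<iota> a', \<iota> b']" "Tr z' = 0"
    unfolding trace_cone_def by blast
  have "x + y = vector [z + z', \<iota> (a + a'), \<iota> (b + b')]"
    by (simp add: xy vec_eq_iff forall_3 emb_add)
  then show "x + y \<in> trace_cone"
    using xy by (auto intro!: trace_coneI simp: Tr_add)
next
  fix c x assume "x \<in> trace_cone"
  then obtain z a b where x: "x = vector [z, \<iota> a, \<iota> b]" "Tr z = 0"
    unfolding trace_cone_def by blast
  have "restrict_scale \<iota> c x = vector [\<iota> c * z, \<iota> (c * a), \<iota> (c * b)]"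
    by (simp add: x restrict_scale_def vec_eq_iff forall_3 emb_mult)
  then show "restrict_scale \<iota> c x \<in> trace_cone"
    using x by (auto intro!: trace_coneI simp: Tr_scale)
qed

lemma dim_trace_cone: "kv.dim trace_cone = 5"
proof -
  let ?f = "\<lambda>(z, a, b). vector [z, \<iota> a, \<iota> b] :: 'l^3"
  have eq: "trace_cone = ?f ` ({z. Tr z = 0} \<times> UNIV)"
    by (force simp: trace_cone_def image_iff)
  have inj: "inj ?f"
    by (auto simp: inj_def vec_eq_iff forall_3)
  have "card trace_cone = card ({z. Tr z = 0} \<times> (UNIV :: ('k \<times> 'k) set))"
    unfolding eq by (rule card_image[OF inj_on_subset[OF inj subset_UNIV]])
  also have "\<dots> = q ^ 3 * (q * q)"
    by (simp add: card_cartesian_product card_ker_Tr card_k flip: UNIV_Times_UNIV)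
  also have "\<dots> = q ^ 5"
    by (simp add: power3_eq_cube eval_nat_numeral mult_ac)
  finally have "q ^ kv.dim trace_cone = q ^ 5"
    using card_subspace[OF subspace_trace_cone] by simp
  then show ?thesis
    using q_gt_1 by simp
qed

text \<open>Some \<open>h0\<close> of trace zero has \<open>Tr (t * h0) \<noteq> 0\<close>, so a
  multiple of \<open>t * h0\<close> over \<open>'k\<close> has the same trace as
  \<open>s\<close>.\<close>

lemma ker_Tr_plus_mult:
  assumes "t \<notin> range \<iota>"
  obtains h h' where "Tr h = 0" "Tr h' = 0" "s = h + t * h'"
proof -
  obtain h0 where h0: "Tr h0 = 0" "Tr (t * h0) \<noteq> 0"
    using Tr_mult_nonzero[OF assms] .
  obtain a b where a: "Tr (t * h0) = \<iota> a" and b: "Tr s = \<iota> b"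
    using Tr_in_range by (meson rangeE)
  let ?h' = "\<iota> (b / a) * h0"
  have "Tr (t * ?h') = \<iota> (b / a) * Tr (t * h0)"
    using Tr_scale[of "b / a" "t * h0"] by (simp add: mult.left_commute)
  then have "Tr (t * ?h') = \<iota> b"
    using h0 a by (simp add: emb_divide)
  then have "Tr (s - t * ?h') = 0"
    using b by (simp add: Tr_diff)
  moreover have "Tr ?h' = 0"
    using h0 by (simp add: Tr_scale)
  ultimately show ?thesis
    using that[of "s - t * ?h'" ?h'] by simp
qed

lemma trace_cone_saturating: "one_saturating (linear_set trace_cone)"
proof (rule one_saturatingI)
  fix p :: "'l^3" assume "p \<noteq> 0"
  have p: "p = vector [p $ 1, p $ 2, p $ 3]"
    by (simp add: vec_eq_iff forall_3)
  \<comment> \<open>The vector (1, 0, 0) need not lie in \<open>trace_cone\<close>, as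
    \<open>Tr 1\<close> may be nonzero; (\<open>h0\<close>, 0, 0) represents the same point.\<close>
  obtain h0 where h0: "Tr h0 = 0" "h0 \<noteq> 0"
  proof -
    have "\<not> {z. Tr z = 0} \<subseteq> {0}"
      using card_mono[of "{0}" "{z. Tr z = 0}"] card_ker_Tr q_gt_1 one_less_power[of q 3] by auto
    with that show ?thesis
      by blast
  qed
  let ?goal = "\<lambda>p. \<exists>u\<in>trace_cone. \<exists>v\<in>trace_cone. u \<noteq> 0 \<and> v \<notin> vec.span {u} \<and>
    (\<exists>\<alpha> \<beta>. p = \<alpha> *s u + \<beta> *s v)"
  \<comment> \<open>Such a point is on the line joining (1, 0, 0) and (0, \<open>a\<close>,
    \<open>b\<close>), where \<open>a\<close> and \<open>b\<close> are embedded;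
    \<open>c = 0\<close> covers (1, 0, 0) itself.\<close>
  have rational: "?goal p" if "a \<noteq> 0 \<or> b \<noteq> 0" "p = vector [s, c * \<iota> a, c * \<iota> b]" for a b c s
  proof (intro bexI conjI exI)
    let ?u = "vector [h0, \<iota> 0, \<iota> 0] :: 'l^3" and ?v = "vector [0, \<iota> a, \<iota> b] :: 'l^3"
    show "?u \<noteq> 0"
      using h0 by (simp add: vec_eq_iff forall_3)
    show "?v \<notin> vec.span {?u}"
      using that(1) by (auto simp: vec.span_singleton vec_eq_iff forall_3)
    show "p = (s / h0) *s ?u + c *s ?v"
      using h0 by (simp add: that(2) vec_eq_iff forall_3)
    show "?u \<in> trace_cone" "?v \<in> trace_cone"
      by (rule trace_coneI, fact h0 Tr_0)+
  qed
  consider "p $ 2 = 0" "p $ 3 = 0" | "p $ 2 = 0" "p $ 3 \<noteq> 0"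
    | b where "p $ 2 \<noteq> 0" "p $ 3 / p $ 2 = \<iota> b" | "p $ 2 \<noteq> 0" "p $ 3 / p $ 2 \<notin> range \<iota>"
    by blast
  then show "?goal p"
  proof cases
    case 1
    then show ?thesis
      using rational[of 1 0 "p $ 1" 0] p by simp
  next
    case 2
    then show ?thesis
      using rational[of 0 1 "p $ 1" "p $ 3"] p by simp
  next
    case 3
    then have "p $ 3 = p $ 2 * \<iota> b"
      by (simp add: field_simps)
    then show ?thesis
      using rational[of 1 b "p $ 1" "p $ 2"] p by simp
  next
    case 4
    define c t where "c = p $ 2" and "t = p $ 3 / p $ 2"
    have "c \<noteq> 0" "p $ 3 = c * t" "p $ 2 = c"
      using 4 by (simp_all add: c_def t_def)
    obtain h h' where h: "Tr h = 0" "Tr h' = 0" "p $ 1 / c = h + t * h'"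
      using ker_Tr_plus_mult 4(2) unfolding t_def by metis
    have "p $ 1 = c * (h + t * h')"
      using h(3) \<open>c \<noteq> 0\<close> by (simp add: field_simps)
    show ?thesis
    proof (intro bexI conjI exI)
      let ?u = "vector [h, \<iota> 1, \<iota> 0] :: 'l^3" and ?v = "vector [h', \<iota> 0, \<iota> 1] :: 'l^3"
      show "?u \<noteq> 0"
        by (simp add: vec_eq_iff forall_3)
      show "?v \<notin> vec.span {?u}"
        by (auto simp: vec.span_singleton vec_eq_iff forall_3)
      show "p = c *s ?u + (c * t) *s ?v"
        using \<open>p $ 1 = _\<close> \<open>p $ 2 = _\<close> \<open>p $ 3 = _\<close>
        by (simp add: vec_eq_iff forall_3 algebra_simps)
      show "?u \<in> trace_cone" "?v \<in> trace_cone"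
        by (rule trace_coneI, fact h)+
    qed
  qed
qed

end

theorem theorem3p5:
  fixes q :: nat
    and \<iota> :: "'k::{field,finite} \<Rightarrow> 'l::{field,finite}"
  assumes "primepow q"
    and "CARD('k) = q"
    and "CARD('l) = q ^ 4"
    and "field_embedding \<iota>"
  shows "min_saturating_rank \<iota> = 5"
proof -
  interpret quartic_extension q \<iota>
    by unfold_locales (fact assms)+
  show ?thesis
    unfolding min_saturating_rank_def
  proof (rule cInf_eq_minimum)
    show "5 \<in> {n. \<exists>U :: ('l^3) set. kv.subspace U \<and> kv.dim U = n \<and> one_saturating (linear_set U)}"
      using subspace_trace_cone dim_trace_cone trace_cone_saturating by blast
  qed (use saturating_dim_ge in blast)
qed

end
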